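(* Let $\mathcal{H}$ be an infinite-dimensional complex Hilbert space and let $S$ be a densely defined symmetric operator in $\mathcal{H}$ with gap $(a,b)\ni 0$ and with infinite deficiency index, i.e. $\dim\ker S^*=\infty$. Let $S_{\mathrm D}$ be a distinguished self-adjoint extension of $S$ with $\sigma(S_{\mathrm D})\cap(a,b)=\emptyset$ (in particular $S_{\mathrm D}^{-1}$ is everywhere defined and bounded). Let $(\lambda_n)_{n\in\mathcal{N}}$ be an arbitrary finite or countably infinite collection of (possibly repeated) points in $(a,b)$. Let $T$ be the self-adjoint operator in the Hilbert subspace $U\subset\ker S^*$ constructed from $S$, $S_{\mathrm D}$, $(\lambda_n)_{n\in\mathcal N}$ and an orthonormal system $(v_n)_{n\in\mathcal N}$ with $S^*v_n=\lambda_nv_n$ as described in the context, with matrix elements $\langle u_m,Tu_n\rangle=\lambda_n\langle u_m,v_n\rangle$, $m,n\in\mathcal N$. Then the self-adjoint extension $S_T$ of $S$ labelled by $T$, namely $S_T=S^*\upharpoonright\mathcal{D}(S_T)$ with $$\mathcal{D}(S_T)=\left\{f+S_{\mathrm D}^{-1}(Tv+w)+v \;\middle|\; f\in\mathcal{D}(\overline{S}),\ v\in\mathcal{D}(T),\ w\in\ker S^*\cap\mathcal{D}(T)^\perp\right\},$$ has all the $\lambda_n$'s as eigenvalues. Moreover, if $\lambda$ is any of these values, then its multiplicity as an eigenvalue of $S_T$ is no less than the number of indices $n\in\mathcal{N}$ with $\lambda_n=\lambda$.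
   Context: The scalar product $\langle\cdot,\cdot\rangle$ is anti-linear in the first entry; $\mathcal{D}(A)$ is the domain of $A$, and $\overline{S}$ is the operator closure of $S$. Gap: a densely defined symmetric operator $S$ has gap $(a,b)$, with $-\infty\leqslant a<b<+\infty$, if for all $f\in\mathcal{D}(S)$: $\langle f,Sf\rangle\geqslant b\|f\|^2$ when $a=-\infty$, and $\|(S-\frac{a+b}{2}\mathbf{1})f\|\geqslant\frac{b-a}{2}\|f\|$ when $a>-\infty$. Equivalently, $S$ has a self-adjoint extension whose spectrum does not intersect $(a,b)$. Extension classification: for each self-adjoint operator $T$ acting in a Hilbert (i.e. closed) subspace of $\ker S^*$ (densely defined in that subspace), the operator $S_T=S^*\upharpoonright\mathcal{D}(S_T)$, with $\mathcal{D}(S_T)$ as in the claim, is a self-adjoint extension of $S$, and $T\leftrightarrow S_T$ is a one-to-one correspondence between such operators $T$ and the self-adjoint extensions of $S$ (Krein-Vishik-Birman theory). $T$ is called the Birman parameter of $S_T$. Construction of $T$: let $(v_n)_{n\in\mathcal{N}}$ be an orthonormal system in $\mathcal{D}(S^* )$ with $S^*v_n=\lambda_nv_n$ for all $n\in\mathcal{N}$ (such a system exists because $\dim\ker(S^*-\lambda_n\mathbf{1})=\infty$ for every $n$). Set $$u_n:=(S_{\mathrm D}-\lambda_n\mathbf{1})S_{\mathrm D}^{-1}v_n\in\ker S^*,\qquad n\in\mathcal{N},$$ and $$V:=\bigoplus_{n\in\mathcal{N}}\mathrm{span}\{v_n\},\qquad U:=\overline{\mathrm{span}\{u_n\,|\,n\in\mathcal{N}\}}\subset\ker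 S^*.$$ Let $\widetilde{T}$ be the self-adjoint operator in $V$ obtained by linear extension and operator closure from the matrix elements $$\langle v_m,\widetilde{T}v_n\rangle:=\lambda_n\langle v_m,v_n\rangle-\lambda_m\lambda_n\langle v_m,S_{\mathrm D}^{-1}v_n\rangle$$ with respect to the orthonormal basis $(v_n)_{n\in\mathcal N}$ of $V$, and let $T$ be the corresponding self-adjoint operator in $U$ via the linear bijection $V\to U$ induced by $v_n\mapsto u_n$, in the sense that $$\langle u_m,Tu_n\rangle=\langle v_m,\widetilde{T}v_n\rangle=\lambda_n\langle u_m,v_n\rangle=\lambda_n\langle u_m,S_{\mathrm D}(S_{\mathrm D}-\lambda_n\mathbf{1})^{-1}u_n\rangle,\qquad m,n\in\mathcal{N}.$$
   Formalization: That the operator T constructed from the matrix elements by linear extension and closure is self-adjoint in U is taken as a hypothesis; it can fail when the points λ_n accumulate at an edge of the gap, and then the self-adjoint T of the statement is not defined. *)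

theory Defs
  imports "HOL-Analysis.Analysis" "HOL-Library.Extended_Nat" "HOL-Library.Extended_Real"
begin

section \<open>Complex Hilbert spaces\<close>

class complex_hilbert_space = banach +
  fixes scaleC :: "complex \<Rightarrow> 'a \<Rightarrow> 'a"  (infixr "*\<^sub>C" 75)
    and cinner :: "'a \<Rightarrow> 'a \<Rightarrow> complex"  \<comment> \<open>anti-linear in the first entry\<close>
  assumes scaleC_add_right: "c *\<^sub>C (x + y) = c *\<^sub>C x + c *\<^sub>C y"
    and scaleC_add_left: "(c + d) *\<^sub>C x = c *\<^sub>C x + d *\<^sub>C x"
    and scaleC_scaleC: "c *\<^sub>C d *\<^sub>C x = (c * d) *\<^sub>C x"
    and scaleC_of_real: "complex_of_real r *\<^sub>C x = r *\<^sub>R x"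
    and cinner_commute: "cinner x y = cnj (cinner y x)"
    and cinner_add_right: "cinner x (y + z) = cinner x y + cinner x z"
    and cinner_scaleC_right: "cinner x (c *\<^sub>C y) = c * cinner x y"
    and cinner_self: "cinner x x = complex_of_real ((norm x)\<^sup>2)"

global_interpretation complex_vector: vector_space
  "scaleC :: complex \<Rightarrow> 'a \<Rightarrow> 'a::complex_hilbert_space"
  defines cspan = complex_vector.span
    and cdim = complex_vector.dim
proof unfold_locales
  show "1 *\<^sub>C x = x" for x :: 'a
    using scaleC_of_real[of 1 x] by simp
qed (simp_all add: scaleC_add_right scaleC_add_left scaleC_scaleC)

text \<open>The library dimension \<^const>\<open>cdim\<close> is \<open>0\<close> on infinite-dimensional spaces, so we use an
  extended dimension. The argument is meant to be a linear subspace.\<close>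

definition cdimension :: "'a::complex_hilbert_space set \<Rightarrow> enat" where
  "cdimension W = (if \<exists>B. finite B \<and> W \<subseteq> cspan B then enat (cdim W) else \<infinity>)"

definition ecard :: "'i set \<Rightarrow> enat" where
  "ecard I = (if finite I then enat (card I) else \<infinity>)"

definition orthonormal_system :: "'i set \<Rightarrow> ('i \<Rightarrow> 'a::complex_hilbert_space) \<Rightarrow> bool" where
  "orthonormal_system N v \<longleftrightarrow>
     (\<forall>m\<in>N. \<forall>n\<in>N. cinner (v m) (v n) = (if m = n then 1 else 0))"

definition orth_complement :: "'a::complex_hilbert_space set \<Rightarrow> 'a set" where
  "orth_complement M = {y. \<forall>x\<in>M. cinner x y = 0}"


section \<open>Unbounded operators, as graphs\<close>

text \<open>An operator is identified with its graph: its domain is \<^const>\<open>Domain\<close>, extension of operators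
  is inclusion, the inverse of an injective operator is the converse relation, and the operator
  closure is the topological closure of the graph.\<close>

type_synonym 'a graph = "('a \<times> 'a) set"

definition scaleC_pair :: "complex \<Rightarrow> 'a::complex_hilbert_space \<times> 'a \<Rightarrow> 'a \<times> 'a" where
  "scaleC_pair c p = (c *\<^sub>C fst p, c *\<^sub>C snd p)"

global_interpretation graph: vector_space
  "scaleC_pair :: complex \<Rightarrow> 'a::complex_hilbert_space \<times> 'a \<Rightarrow> 'a \<times> 'a"
  defines graph_span = graph.span
    and graph_subspace = graph.subspace
  by unfold_locales
    (auto simp: scaleC_pair_def scaleC_add_right scaleC_add_left scaleC_scaleC prod_eq_iff)

definition linear_operator :: "'a::complex_hilbert_space graph \<Rightarrow> bool" where
  "linear_operator A \<longleftrightarrow> graph_subspace A \<and> single_valued A"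

definition op_app :: "'a graph \<Rightarrow> 'a \<Rightarrow> 'a" where
  "op_app A x = (THE y. (x, y) \<in> A)"

lemma op_app_eq: "single_valued A \<Longrightarrow> (x, y) \<in> A \<Longrightarrow> op_app A x = y"
  by (auto simp: op_app_def single_valued_def)

definition op_ker :: "'a::complex_hilbert_space graph \<Rightarrow> 'a set" where
  "op_ker A = {x. (x, 0) \<in> A}"

text \<open>The operator \<open>A - z\<close>.\<close>

definition op_shift :: "'a::complex_hilbert_space graph \<Rightarrow> complex \<Rightarrow> 'a graph" where
  "op_shift A z = {(x, y - z *\<^sub>C x) |x y. (x, y) \<in> A}"

definition densely_defined :: "'a::complex_hilbert_space graph \<Rightarrow> bool" where
  "densely_defined A \<longleftrightarrow> closure (Domain A) = UNIV"

definition symmetric_operator :: "'a::complex_hilbert_space graph \<Rightarrow> bool" where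
  "symmetric_operator A \<longleftrightarrow> (\<forall>(x, x')\<in>A. \<forall>(y, y')\<in>A. cinner x y' = cinner x' y)"

text \<open>The adjoint of an operator \<open>A\<close> acting in, and densely defined in, the Hilbert subspace \<open>M\<close>.\<close>

definition adjoint_in :: "'a::complex_hilbert_space set \<Rightarrow> 'a graph \<Rightarrow> 'a graph" where
  "adjoint_in M A = {(y, z) \<in> M \<times> M. \<forall>(x, x')\<in>A. cinner y x' = cinner z x}"

definition self_adjoint_in :: "'a::complex_hilbert_space set \<Rightarrow> 'a graph \<Rightarrow> bool" where
  "self_adjoint_in M A \<longleftrightarrow>
     linear_operator A \<and> A \<subseteq> M \<times> M \<and> M \<subseteq> closure (Domain A) \<and> adjoint_in M A = A"

abbreviation op_adjoint :: "'a::complex_hilbert_space graph \<Rightarrow> 'a graph" where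
  "op_adjoint \<equiv> adjoint_in UNIV"

abbreviation self_adjoint :: "'a::complex_hilbert_space graph \<Rightarrow> bool" where
  "self_adjoint \<equiv> self_adjoint_in UNIV"

definition resolvent_set :: "'a::complex_hilbert_space graph \<Rightarrow> complex set" where
  "resolvent_set A = {z. single_valued ((op_shift A z)\<inverse>) \<and> Domain ((op_shift A z)\<inverse>) = UNIV \<and>
     (\<exists>C. \<forall>(y, x)\<in>(op_shift A z)\<inverse>. norm x \<le> C * norm y)}"

definition spectrum :: "'a::complex_hilbert_space graph \<Rightarrow> complex set" where
  "spectrum A = - resolvent_set A"

definition eigenspace :: "'a::complex_hilbert_space graph \<Rightarrow> complex \<Rightarrow> 'a set" where
  "eigenspace A z = op_ker (op_shift A z)"

definition eigenvalue :: "'a::complex_hilbert_space graph \<Rightarrow> complex \<Rightarrow> bool" where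
  "eigenvalue A z \<longleftrightarrow> (\<exists>x\<in>eigenspace A z. x \<noteq> 0)"

definition eigenvalue_multiplicity :: "'a::complex_hilbert_space graph \<Rightarrow> complex \<Rightarrow> enat" where
  "eigenvalue_multiplicity A z = cdimension (eigenspace A z)"


section \<open>Gaps\<close>

definition gap_interval :: "ereal \<Rightarrow> real \<Rightarrow> real set" where
  "gap_interval a b = {t. a < ereal t \<and> t < b}"

text \<open>In the case \<open>a = -\<infinity>\<close> the number \<open>cinner f g\<close> is real, since \<open>S\<close> is meant to be symmetric.\<close>

definition has_gap :: "'a::complex_hilbert_space graph \<Rightarrow> ereal \<Rightarrow> real \<Rightarrow> bool" where
  "has_gap S a b \<longleftrightarrow> a < ereal b \<and>
     (\<forall>(f, g)\<in>S.
        if a = -\<infinity> then Re (cinner f g) \<ge> b * (norm f)\<^sup>2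
        else norm (g - ((real_of_ereal a + b) / 2) *\<^sub>R f) \<ge> (b - real_of_ereal a) / 2 * norm f)"


section \<open>The extension with Birman parameter \<open>T\<close>\<close>

definition birman_extension ::
    "'a::complex_hilbert_space graph \<Rightarrow> 'a graph \<Rightarrow> 'a graph \<Rightarrow> 'a graph" where
  "birman_extension S SD T = {(g, h) \<in> op_adjoint S.
     g \<in> {f + op_app (SD\<inverse>) (op_app T v + w) + v |f v w.
            f \<in> Domain (closure S) \<and> v \<in> Domain T \<and>
            w \<in> op_ker (op_adjoint S) \<inter> orth_complement (Domain T)}}"


section \<open>The Birman parameter built from an orthonormal system\<close>

definition birman_vector ::
    "'a::complex_hilbert_space graph \<Rightarrow> ('i \<Rightarrow> real) \<Rightarrow> ('i \<Rightarrow> 'a) \<Rightarrow> 'i \<Rightarrow> 'a" where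
  "birman_vector SD lam v n =
     op_app (op_shift SD (complex_of_real (lam n))) (op_app (SD\<inverse>) (v n))"

text \<open>The matrix of the operator in \<open>V\<close> with respect to \<open>v\<close>, which by definition is also the matrix
  of the Birman parameter with respect to the vectors \<open>birman_vector SD lam v n\<close>.\<close>

definition birman_matrix ::
    "'a::complex_hilbert_space graph \<Rightarrow> ('i \<Rightarrow> real) \<Rightarrow> ('i \<Rightarrow> 'a) \<Rightarrow> 'i \<Rightarrow> 'i \<Rightarrow> complex" where
  "birman_matrix SD lam v m n =
     complex_of_real (lam n) * cinner (v m) (v n) -
     complex_of_real (lam m * lam n) * cinner (v m) (op_app (SD\<inverse>) (v n))"

lemma birman_matrix_eq:
  assumes sa: "self_adjoint SD" and inv: "single_valued (SD\<inverse>)" "Domain (SD\<inverse>) = UNIV"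
  shows "birman_matrix SD lam v m n = complex_of_real (lam n) * cinner (birman_vector SD lam v m) (v n)"
proof -
  define R where "R = op_app (SD\<inverse>)"
  have R: "(R x, x) \<in> SD" for x
  proof -
    obtain y where "(x, y) \<in> SD\<inverse>" using inv(2) by blast
    then show ?thesis using op_app_eq[OF inv(1), of x y] by (simp add: R_def)
  qed
  have sv: "single_valued SD"
    using sa by (simp add: self_adjoint_in_def linear_operator_def)
  have u: "birman_vector SD lam v m = v m - complex_of_real (lam m) *\<^sub>C R (v m)"
    unfolding birman_vector_def R_def[symmetric]
    using R[of "v m"] sv by (intro op_app_eq) (auto simp: op_shift_def single_valued_def)
  have "(R (v m), v m) \<in> op_adjoint SD"
    using sa R by (simp add: self_adjoint_in_def)
  then have sym: "cinner (R (v m)) (v n) = cinner (v m) (R (v n))"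
    using R[of "v n"] by (auto simp: adjoint_in_def)
  have "cinner (v n) (birman_vector SD lam v m) + complex_of_real (lam m) * cinner (v n) (R (v m)) =
      cinner (v n) (v m)"
    by (simp add: u flip: cinner_scaleC_right cinner_add_right)
  then have "cnj (cinner (v n) (birman_vector SD lam v m)) +
      complex_of_real (lam m) * cnj (cinner (v n) (R (v m))) = cnj (cinner (v n) (v m))"
    by (metis complex_cnj_add complex_cnj_mult complex_cnj_complex_of_real)
  then have "cinner (birman_vector SD lam v m) (v n) =
      cinner (v m) (v n) - complex_of_real (lam m) * cinner (v m) (R (v n))"
    by (simp add: eq_diff_eq sym flip: cinner_commute)
  then show ?thesis
    unfolding birman_matrix_def R_def[symmetric] by (simp only: right_diff_distrib of_real_mult mult_ac)
qed

text \<open>The operator in the closed span of the vectors \<open>e n\<close> (\<open>n \<in> N\<close>) obtained by linear extension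
  and operator closure from the matrix elements \<open>M m n\<close>. Each \<open>e n\<close> is mapped to the vector \<open>y\<close> of
  the closed span with \<open>cinner (e m) y = M m n\<close> for all \<open>m\<close>; there is at most one such \<open>y\<close>.\<close>

definition matrix_operator ::
    "'i set \<Rightarrow> ('i \<Rightarrow> 'a::complex_hilbert_space) \<Rightarrow> ('i \<Rightarrow> 'i \<Rightarrow> complex) \<Rightarrow> 'a graph" where
  "matrix_operator N e M = closure (graph_span
     {(e n, y) |n y. n \<in> N \<and> y \<in> closure (cspan (e ` N)) \<and> (\<forall>m\<in>N. cinner (e m) y = M m n)})"

end

theory Submission
  imports Defs
begin

text \<open>
  Put \<open>R = SD\<^sup>-\<^sup>1\<close>, which is bounded because \<open>0\<close> lies in the gap. A pair \<open>(x, y)\<close> of the adjoint of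
  \<open>S\<close> belongs to the extension iff \<open>x - R y\<close> lies in the domain of \<open>T\<close> and the orthogonal projection
  of \<open>y\<close> onto \<open>U\<close> is \<open>T (x - R y)\<close>. This makes self-adjointness a consequence of that of \<open>T\<close>. For
  \<open>(x, y) = (v n, lam n *\<^sub>C v n)\<close> one has \<open>x - R y = u n\<close>, and the matrix elements of \<open>T\<close> say exactly
  that \<open>T (u n)\<close> is the projection of \<open>lam n *\<^sub>C v n\<close> onto \<open>U\<close>; hence \<open>v n\<close> is an eigenvector. The
  multiplicity bound is the linear independence of the orthonormal vectors \<open>v n\<close>.
\<close>

section \<open>Complex inner products and orthogonal projections\<close>

lemma cinner_add_left: "cinner (x + y) z = cinner x z + cinner y z"
  by (metis cinner_add_right cinner_commute complex_cnj_add)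

lemma cinner_scaleC_left: "cinner (c *\<^sub>C x) y = cnj c * cinner x y"
  by (metis cinner_commute cinner_scaleC_right complex_cnj_mult)

lemma cinner_zero_right [simp]: "cinner x 0 = 0"
  using cinner_add_right[of x 0 0] by simp

lemma cinner_zero_left [simp]: "cinner 0 x = 0"
  using cinner_add_left[of 0 0 x] by simp

lemma cinner_diff_right: "cinner x (y - z) = cinner x y - cinner x z"
  using cinner_add_right[of x "y - z" z] by simp

lemma cinner_diff_left: "cinner (x - y) z = cinner x z - cinner y z"
  using cinner_add_left[of "x - y" y z] by simp

lemma cinner_eq_0_commute: "cinner x y = 0 \<longleftrightarrow> cinner y x = 0"
  by (metis cinner_commute complex_cnj_zero)

lemma cinner_self_eq_0 [simp]: "cinner x x = 0 \<longleftrightarrow> x = 0"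
  by (simp add: cinner_self)

section \<open>Norm identities and the Cauchy-Schwarz inequality\<close>

lemma power2_norm_eq_cinner: "(norm x)\<^sup>2 = Re (cinner x x)"
  by (simp add: cinner_self)

lemma norm_scaleC: "norm (c *\<^sub>C x) = cmod c * norm x"
proof -
  have "cinner (c *\<^sub>C x) (c *\<^sub>C x) = (c * cnj c) * of_real ((norm x)\<^sup>2)"
    by (simp add: cinner_scaleC_left cinner_scaleC_right cinner_self[of x] mult_ac)
  also have "\<dots> = of_real ((cmod c * norm x)\<^sup>2)"
    by (simp only: complex_norm_square[symmetric] of_real_mult power_mult_distrib)
  finally have "cinner (c *\<^sub>C x) (c *\<^sub>C x) = of_real ((cmod c * norm x)\<^sup>2)" .
  then have "(norm (c *\<^sub>C x))\<^sup>2 = (cmod c * norm x)\<^sup>2"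
    by (simp add: power2_norm_eq_cinner del: of_real_power)
  then show ?thesis by simp
qed

text \<open>A quadratic in \<open>t\<close> that serves twice: for Cauchy-Schwarz and for the
  orthogonality of vectors of minimal norm. For \<open>y \<noteq> 0\<close> the value
  \<open>t = 1 / (norm y)\<^sup>2\<close> gives the true projection onto \<open>y\<close>.\<close>

lemma norm_diff_scaled_projection:
  "(norm (x - (of_real t * cinner y x) *\<^sub>C y))\<^sup>2 =
   (norm x)\<^sup>2 - 2 * t * (cmod (cinner y x))\<^sup>2 + t\<^sup>2 * (cmod (cinner y x))\<^sup>2 * (norm y)\<^sup>2"
proof -
  define c where "c = cinner y x"
  have xy: "cinner x y = cnj c" by (metis c_def cinner_commute)
  have "cinner (x - (of_real t * c) *\<^sub>C y) (x - (of_real t * c) *\<^sub>C y) =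
      of_real ((norm x)\<^sup>2) - 2 * of_real t * (c * cnj c)
        + (of_real t)\<^sup>2 * (c * cnj c) * of_real ((norm y)\<^sup>2)"
    by (simp add: cinner_diff_left cinner_diff_right cinner_scaleC_left cinner_scaleC_right
        cinner_self[of x] cinner_self[of y] xy c_def[symmetric] algebra_simps power2_eq_square)
  also have "\<dots> = of_real ((norm x)\<^sup>2 - 2 * t * (cmod c)\<^sup>2 + t\<^sup>2 * (cmod c)\<^sup>2 * (norm y)\<^sup>2)"
    by (simp only: complex_norm_square[symmetric] of_real_add of_real_diff of_real_mult of_real_power
        of_real_numeral)
  finally show ?thesis
    by (simp only: power2_norm_eq_cinner[of "x - _"] c_def Re_complex_of_real)
qed

lemma norm_cinner_le: "cmod (cinner x y) \<le> norm x * norm y"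
proof (cases "x = 0")
  case False
  \<comment> \<open>This \<open>t\<close> minimises the quadratic; its nonnegativity there is the
    claim.\<close>
  define t where "t = 1 / (norm x)\<^sup>2"
  have t: "t * (norm x)\<^sup>2 = 1" "t > 0"
    using False by (auto simp: t_def)
  have "0 \<le> (norm y)\<^sup>2 - 2 * t * (cmod (cinner x y))\<^sup>2 + t * (t * (norm x)\<^sup>2) * (cmod (cinner x y))\<^sup>2"
    using norm_diff_scaled_projection[of y t x] zero_le_power2[of "norm (y - (of_real t * cinner x y) *\<^sub>C x)"]
    by (simp add: power2_eq_square mult_ac)
  then have "t * (cmod (cinner x y))\<^sup>2 \<le> (norm y)\<^sup>2"
    by (simp add: t)
  then have "(cmod (cinner x y))\<^sup>2 \<le> (norm x * norm y)\<^sup>2"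
    using False by (simp add: t_def power_mult_distrib field_simps)
  then show ?thesis
    by (rule power2_le_imp_le) simp
qed simp

section \<open>Continuity of the inner product and of scalar multiplication\<close>

lemma scaleR_eq_scaleC: "r *\<^sub>R x = complex_of_real r *\<^sub>C x"
  by (simp add: scaleC_of_real)

lemma bounded_linear_cinner_right: "bounded_linear (cinner x)"
proof (rule bounded_linear_intro[where K = "norm x"])
  show "cinner x (r *\<^sub>R y) = r *\<^sub>R cinner x y" for r y
    by (simp add: scaleR_eq_scaleC cinner_scaleC_right scaleR_conv_of_real)
  show "cmod (cinner x y) \<le> norm y * norm x" for y
    using norm_cinner_le[of x y] by (simp add: mult.commute)
qed (rule cinner_add_right)

text \<open>The map is anti-linear over the complex numbers but linear over the reals, so
  \<open>bounded_linear\<close> applies and yields continuity in the first entry as well.\<close>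

lemma bounded_linear_cinner_left: "bounded_linear (\<lambda>x. cinner x y)"
proof (rule bounded_linear_intro[where K = "norm y"])
  show "cinner (r *\<^sub>R x) y = r *\<^sub>R cinner x y" for r x
    by (simp add: scaleR_eq_scaleC cinner_scaleC_left scaleR_conv_of_real)
qed (auto simp: cinner_add_left norm_cinner_le)

lemma bounded_linear_scaleC: "bounded_linear (scaleC c :: 'a \<Rightarrow> 'a::complex_hilbert_space)"
proof (rule bounded_linear_intro[where K = "cmod c"])
  show "c *\<^sub>C r *\<^sub>R x = r *\<^sub>R c *\<^sub>C x" for r and x :: 'a
    by (simp add: scaleR_eq_scaleC scaleC_scaleC mult.commute)
qed (auto simp: scaleC_add_right norm_scaleC)

lemmas continuous_cinner_right [continuous_intros] =
    bounded_linear.continuous_on[OF bounded_linear_cinner_right]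
  and continuous_cinner_left [continuous_intros] =
    bounded_linear.continuous_on[OF bounded_linear_cinner_left]
  and tendsto_scaleC_right [tendsto_intros] = bounded_linear.tendsto[OF bounded_linear_scaleC]

section \<open>Orthogonal complements and closures\<close>

lemma closed_orth_complement: "closed (orth_complement M)"
proof -
  have "orth_complement M = (\<Inter>x\<in>M. {y. cinner x y = 0})"
    by (auto simp: orth_complement_def)
  then show ?thesis
    by (auto intro!: closed_INT closed_Collect_eq continuous_intros)
qed

text \<open>For fixed \<open>y\<close> the vectors \<open>x\<close> with
  \<open>cinner x y = 0\<close> form a closed set, so orthogonality to \<open>M\<close> passes to
  limits.\<close>

lemma orth_complement_closure: "orth_complement (closure M) = orth_complement M"
proof
  show "orth_complement M \<subseteq> orth_complement (closure M)"
  proof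
    fix y assume "y \<in> orth_complement M"
    then have "M \<subseteq> {x. cinner x y = 0}" by (auto simp: orth_complement_def)
    then have "closure M \<subseteq> {x. cinner x y = 0}"
      by (rule closure_minimal) (auto intro!: closed_Collect_eq continuous_intros)
    then show "y \<in> orth_complement (closure M)" by (auto simp: orth_complement_def)
  qed
qed (use closure_subset in \<open>auto simp: orth_complement_def\<close>)

lemma subspace_closure: "complex_vector.subspace M \<Longrightarrow> complex_vector.subspace (closure M)"
  unfolding complex_vector.subspace_def
proof (intro conjI ballI allI; elim conjE)
  fix x y assume add: "\<forall>x\<in>M. \<forall>y\<in>M. x + y \<in> M" and x: "x \<in> closure M" and y: "y \<in> closure M"
  from x y obtain f g where "\<And>n. f n \<in> M" "f \<longlonglongrightarrow> x" "\<And>n. g n \<in> M" "g \<longlonglongrightarrow> y"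
    by (metis closure_sequential)
  then show "x + y \<in> closure M"
    unfolding closure_sequential
    by (intro exI[of _ "\<lambda>n. f n + g n"]) (auto intro: tendsto_intros simp: add)
next
  fix c x assume scale: "\<forall>c. \<forall>x\<in>M. c *\<^sub>C x \<in> M" and x: "x \<in> closure M"
  from x obtain f where "\<And>n. f n \<in> M" "f \<longlonglongrightarrow> x"
    by (metis closure_sequential)
  then show "c *\<^sub>C x \<in> closure M"
    unfolding closure_sequential
    by (intro exI[of _ "\<lambda>n. c *\<^sub>C f n"]) (auto intro: tendsto_intros simp: scale)
qed (use closure_subset[of M] in auto)

section \<open>Existence of orthogonal projections\<close>

lemma parallelogram_law:
  "(norm (x + y))\<^sup>2 + (norm (x - y :: 'a::complex_hilbert_space))\<^sup>2 = 2 * (norm x)\<^sup>2 + 2 * (norm y)\<^sup>2"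
  by (simp add: power2_norm_eq_cinner cinner_add_left cinner_add_right cinner_diff_left cinner_diff_right)

text \<open>If \<open>cinner q r\<close> were nonzero, subtracting from \<open>r\<close> its
  projection onto \<open>q\<close> would shorten it.\<close>

lemma minimal_norm_orthogonal:
  assumes "complex_vector.subspace M" "\<And>q. q \<in> M \<Longrightarrow> norm r \<le> norm (r - q)"
  shows "r \<in> orth_complement M"
proof -
  have "cinner q r = 0" if q: "q \<in> M" for q
  proof (cases "q = 0")
    case False
    define t where "t = 1 / (norm q)\<^sup>2"
    have t: "t * (norm q)\<^sup>2 = 1" "t > 0"
      using False by (auto simp: t_def)
    have "(norm r)\<^sup>2 \<le> (norm (r - (of_real t * cinner q r) *\<^sub>C q))\<^sup>2"
      using assms q by (intro power_mono) (auto simp: complex_vector.subspace_def)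
    also have "\<dots> = (norm r)\<^sup>2 - 2 * t * (cmod (cinner q r))\<^sup>2 + t * (t * (norm q)\<^sup>2) * (cmod (cinner q r))\<^sup>2"
      unfolding norm_diff_scaled_projection by (simp add: power2_eq_square mult_ac)
    finally have "t * (cmod (cinner q r))\<^sup>2 \<le> 0"
      by (simp add: t)
    with t(2) show ?thesis
      by (simp add: mult_le_0_iff)
  qed simp
  then show ?thesis by (auto simp: orth_complement_def)
qed

text \<open>A minimising sequence for the distance from \<open>x\<close> to \<open>M\<close> is
  Cauchy by the parallelogram law. Its limit attains the distance, so
  \<open>minimal_norm_orthogonal\<close> applies to the remainder.\<close>

theorem projection_exists:
  fixes M :: "'a::complex_hilbert_space set"
  assumes M: "complex_vector.subspace M" "closed M"
  obtains p where "p \<in> M" "x - p \<in> orth_complement M"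
proof -
  define d where "d = infdist x M"
  have ne: "M \<noteq> {}" using M(1) by (auto simp: complex_vector.subspace_def)
  have d: "d \<le> norm (x - q)" if "q \<in> M" for q
    using that by (simp add: d_def infdist_le flip: dist_norm)
  have d0: "d \<ge> 0" by (simp add: d_def infdist_nonneg)
  have "\<exists>q\<in>M. (norm (x - q))\<^sup>2 < d\<^sup>2 + 1 / Suc n" for n
  proof -
    have "d < sqrt (d\<^sup>2 + 1 / Suc n)"
      by (rule real_less_rsqrt) simp
    then obtain q where q: "q \<in> M" "dist x q < sqrt (d\<^sup>2 + 1 / Suc n)"
      unfolding d_def infdist_def using ne by (auto simp: cINF_less_iff)
    then have "(norm (x - q))\<^sup>2 < (sqrt (d\<^sup>2 + 1 / Suc n))\<^sup>2"
      by (intro power_strict_mono) (auto simp: dist_norm)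
    with q(1) show ?thesis by (auto simp: add_nonneg_nonneg)
  qed
  then obtain p where p: "\<And>n. p n \<in> M" "\<And>n. (norm (x - p n))\<^sup>2 < d\<^sup>2 + 1 / Suc n"
    by metis
  have close: "(norm (p m - p n))\<^sup>2 \<le> 2 / Suc m + 2 / Suc n" for m n
  proof -
    \<comment> \<open>The midpoint stays in \<open>M\<close>, which bounds the sum below by
      \<open>2 * d\<close>. In the parallelogram law this cancels the \<open>d\<^sup>2\<close> terms
      and leaves only the slacks \<open>1 / Suc m\<close> and \<open>1 / Suc n\<close>.\<close>
    have mid: "(1/2) *\<^sub>R (p m + p n) \<in> M"
      using M(1) p(1) by (auto simp: complex_vector.subspace_def scaleR_eq_scaleC)
    have "(x - p m) + (x - p n) = 2 *\<^sub>R (x - (1/2) *\<^sub>R (p m + p n))"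
      by (simp add: algebra_simps scaleR_2)
    then have "norm ((x - p m) + (x - p n)) = 2 * norm (x - (1/2) *\<^sub>R (p m + p n))"
      by simp
    then have "2 * d \<le> norm ((x - p m) + (x - p n))"
      using d[OF mid] by simp
    then have "(2 * d)\<^sup>2 \<le> (norm ((x - p m) + (x - p n)))\<^sup>2"
      using d0 by (intro power_mono) auto
    moreover have "norm ((x - p m) - (x - p n)) = norm (p m - p n)"
      by (simp add: norm_minus_commute)
    ultimately show ?thesis
      using parallelogram_law[of "x - p m" "x - p n"] p(2)[of m] p(2)[of n]
      by (simp add: power_mult_distrib)
  qed
  have "Cauchy p"
  proof (rule metric_CauchyI)
    fix e :: real assume e: "e > 0"
    obtain k where k: "inverse (real (Suc k)) < e\<^sup>2 / 4"
      using reals_Archimedean[of "e\<^sup>2 / 4"] e by auto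
    have "dist (p m) (p n) < e" if "m \<ge> k" "n \<ge> k" for m n
    proof -
      have "2 / Suc i < e\<^sup>2 / 2" if "i \<ge> k" for i
      proof -
        have "1 / real (Suc i) \<le> 1 / real (Suc k)"
          using that by (intro divide_left_mono) auto
        with k show ?thesis by (simp add: inverse_eq_divide)
      qed
      from this[OF that(1)] this[OF that(2)] have "(norm (p m - p n))\<^sup>2 < e\<^sup>2"
        using close[of m n] by linarith
      then show ?thesis
        using e by (simp add: dist_norm power2_less_imp_less)
    qed
    then show "\<exists>k. \<forall>m\<ge>k. \<forall>n\<ge>k. dist (p m) (p n) < e" by blast
  qed
  then obtain l where l: "p \<longlonglongrightarrow> l"
    using Cauchy_convergent convergentD by blast
  have lM: "l \<in> M"
    using M(2) p(1) l by (rule closed_sequentially)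
  have "(norm (x - l))\<^sup>2 \<le> d\<^sup>2"
  proof (rule LIMSEQ_le)
    show "(\<lambda>n. (norm (x - p n))\<^sup>2) \<longlonglongrightarrow> (norm (x - l))\<^sup>2"
      by (intro tendsto_intros l)
    show "(\<lambda>n. d\<^sup>2 + 1 / Suc n) \<longlonglongrightarrow> d\<^sup>2"
      using tendsto_add[OF tendsto_const LIMSEQ_inverse_real_of_nat, of "d\<^sup>2"]
      by (simp add: inverse_eq_divide)
  qed (use p(2) less_imp_le in blast)
  then have "norm (x - l) \<le> d"
    using d0 by (rule power2_le_imp_le)
  moreover have "d \<le> norm (x - l - q)" if "q \<in> M" for q
    using d[of "l + q"] that lM M(1) by (simp add: complex_vector.subspace_def algebra_simps)
  ultimately have "x - l \<in> orth_complement M"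
    by (intro minimal_norm_orthogonal M(1)) (meson order_trans)
  with lM show ?thesis by (rule that)
qed

lemma orth_complement_Int_self: "x \<in> M \<Longrightarrow> x \<in> orth_complement M \<Longrightarrow> x = 0"
  by (auto simp: orth_complement_def)

lemma orth_complement_dense:
  "closure M = UNIV \<Longrightarrow> x \<in> orth_complement M \<Longrightarrow> x = 0"
  using orth_complement_Int_self[of x "closure M"] orth_complement_closure[of M] by simp

section \<open>Graphs of operators\<close>

lemma graph_subspace_iff:
  "graph_subspace A \<longleftrightarrow> (0, 0) \<in> A \<and>
     (\<forall>x y x' y'. (x, y) \<in> A \<longrightarrow> (x', y') \<in> A \<longrightarrow> (x + x', y + y') \<in> A) \<and>
     (\<forall>c x y. (x, y) \<in> A \<longrightarrow> (c *\<^sub>C x, c *\<^sub>C y) \<in> A)"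
  unfolding graph.subspace_def scaleC_pair_def zero_prod_def Ball_def split_paired_All add_Pair
    fst_conv snd_conv
  by blast

lemma graph_subspace_diff:
  assumes "graph_subspace A" "(x, y) \<in> A" "(x', y') \<in> A"
  shows "(x - x', y - y') \<in> A"
  using graph.subspace_diff[OF assms] by simp

lemma op_app_iff: "single_valued A \<Longrightarrow> x \<in> Domain A \<Longrightarrow> op_app A x = y \<longleftrightarrow> (x, y) \<in> A"
  using op_app_eq by fastforce

lemma graph_subspace_adjoint_in:
  "complex_vector.subspace M \<Longrightarrow> graph_subspace (adjoint_in M A)"
  unfolding graph_subspace_iff adjoint_in_def complex_vector.subspace_def Ball_def split_paired_All
  by (simp add: cinner_add_left cinner_scaleC_left)

lemma closed_op_adjoint: "closed (op_adjoint A)"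
proof -
  have "op_adjoint A = (\<Inter>(x, x')\<in>A. {p. cinner (fst p) x' = cinner (snd p) x})"
    by (auto simp: adjoint_in_def)
  also have "closed \<dots>"
    by (auto intro!: closed_INT closed_Collect_eq continuous_intros)
  finally show ?thesis .
qed

text \<open>Read forwards this is the symmetry of \<open>A\<close>; read backwards it proves
  membership in \<open>A\<close> by testing against \<open>A\<close>.\<close>

lemma self_adjoint_in_adjoint_iff:
  assumes "self_adjoint_in M A"
  shows "(x, y) \<in> A \<longleftrightarrow> x \<in> M \<and> y \<in> M \<and> (\<forall>(z, z')\<in>A. cinner x z' = cinner y z)"
proof -
  have "(x, y) \<in> A \<longleftrightarrow> (x, y) \<in> adjoint_in M A"
    using assms by (simp add: self_adjoint_in_def)
  then show ?thesis by (simp add: adjoint_in_def)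
qed

text \<open>Two images of one vector differ by a vector orthogonal to the dense domain.\<close>

lemma single_valued_op_adjoint:
  assumes "densely_defined A"
  shows "single_valued (op_adjoint A)"
proof (rule single_valuedI)
  fix x y z assume "(x, y) \<in> op_adjoint A" "(x, z) \<in> op_adjoint A"
  then have "cinner y f = cinner z f" if "f \<in> Domain A" for f
    using that by (fastforce simp: adjoint_in_def)
  then have "y - z \<in> orth_complement (Domain A)"
    by (auto simp: orth_complement_def cinner_diff_left cinner_eq_0_commute[of _ "y - z"])
  with assms show "y = z"
    using orth_complement_dense[of "Domain A" "y - z"] by (simp add: densely_defined_def)
qed

text \<open>Shows the deficiency space to be closed and to be the orthogonal complement of
  \<open>closure (Range A)\<close>.\<close>

lemma op_ker_op_adjoint: "op_ker (op_adjoint A) = orth_complement (Range A)"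
  by (auto simp: op_ker_def adjoint_in_def orth_complement_def cinner_eq_0_commute)

lemma complex_subspace_Range: "graph_subspace A \<Longrightarrow> complex_vector.subspace (Range A)"
  unfolding graph_subspace_iff complex_vector.subspace_def by blast

lemma op_shift_0 [simp]: "op_shift A 0 = A"
  by (auto simp: op_shift_def)

lemma eigenspace_iff: "x \<in> eigenspace A z \<longleftrightarrow> (x, z *\<^sub>C x) \<in> A"
  by (auto simp: eigenspace_def op_ker_def op_shift_def)

section \<open>Self-adjoint extensions\<close>

text \<open>The gap is used in the form \<open>0 \<in> resolvent_set SD\<close>, which makes the
  inverse of \<open>SD\<close> bounded and everywhere defined.\<close>

locale invertible_self_adjoint_extension =
  fixes S SD :: "'h::complex_hilbert_space graph"
  assumes S_linear: "linear_operator S" and S_dense: "densely_defined S"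
    and SD_self_adjoint: "self_adjoint SD" and S_le_SD: "S \<subseteq> SD"
    and SD_invertible: "0 \<in> resolvent_set SD"
begin

definition R :: "'h \<Rightarrow> 'h" where "R = op_app (SD\<inverse>)"

lemma SD_converse: "single_valued (SD\<inverse>)" "Domain (SD\<inverse>) = UNIV"
  using SD_invertible by (auto simp: resolvent_set_def)

text \<open>The inverse is total and single valued, so \<open>SD\<close> is the graph of
  \<open>R\<close> read backwards. Linearity and symmetry of \<open>R\<close> are read off from
  this.\<close>

lemma SD_iff: "(x, y) \<in> SD \<longleftrightarrow> x = R y"
  using op_app_iff[of "SD\<inverse>" y x] SD_converse unfolding R_def by blast

lemma SD_subspace: "graph_subspace SD"
  using SD_self_adjoint by (simp add: self_adjoint_in_def linear_operator_def)

lemma S_subspace: "graph_subspace S"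
  using S_linear by (simp add: linear_operator_def)

lemma R_add: "R (x + y) = R x + R y" and R_scaleC: "R (c *\<^sub>C x) = c *\<^sub>C R x"
  using SD_subspace unfolding graph_subspace_iff SD_iff by auto

lemma R_0 [simp]: "R 0 = 0"
  using R_add[of 0 0] by simp

lemma R_diff: "R (x - y) = R x - R y"
  using R_add[of "x - y" y] by simp

lemma bounded_linear_R: "bounded_linear R"
proof -
  obtain C where "\<forall>(y, x)\<in>SD\<inverse>. norm x \<le> C * norm y"
    using SD_invertible by (auto simp: resolvent_set_def)
  then have "norm (R y) \<le> norm y * C" for y
    using SD_iff[of "R y" y] by (auto simp: mult.commute)
  then show ?thesis
    by (intro bounded_linear_intro[where K = C]) (auto simp: R_add scaleR_eq_scaleC R_scaleC)
qed

lemma R_symmetric: "cinner (R x) y = cinner x (R y)"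
proof -
  have "(R x, x) \<in> SD" "(R y, y) \<in> SD" by (simp_all add: SD_iff)
  then show ?thesis
    using self_adjoint_in_adjoint_iff[OF SD_self_adjoint, of "R x" x] by fast
qed

section \<open>The adjoint and the closure of \<open>S\<close> in terms of \<open>R\<close>\<close>

lemma closed_SD: "closed SD"
  using SD_self_adjoint closed_op_adjoint[of SD] unfolding self_adjoint_in_def by metis

lemma closure_S_le_SD: "closure S \<subseteq> SD"
  using S_le_SD closed_SD by (rule closure_minimal)

abbreviation K :: "'h set" where "K \<equiv> op_ker (op_adjoint S)"

text \<open>Every pair \<open>(x, x')\<close> of \<open>S\<close> has \<open>x = R x'\<close>, so
  the symmetry of \<open>R\<close> is all that is asked.\<close>

lemma R_in_op_adjoint: "(R y, y) \<in> op_adjoint S"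
proof -
  have "cinner (R y) x' = cinner y x" if "(x, x') \<in> S" for x x'
  proof -
    have "x = R x'" using that S_le_SD by (simp add: subset_iff flip: SD_iff)
    then show ?thesis by (simp add: R_symmetric)
  qed
  then show ?thesis by (simp add: adjoint_in_def split_beta)
qed

lemma op_adjoint_subspace: "graph_subspace (op_adjoint S)"
  by (rule graph_subspace_adjoint_in) (simp add: complex_vector.subspace_UNIV)

text \<open>Subtracting \<open>(R y, y)\<close>, itself in the adjoint, leaves a pair with second
  component \<open>0\<close>. This is the decomposition of the domain of the adjoint into the domain
  of \<open>SD\<close> plus \<open>K\<close>.\<close>

lemma op_adjoint_iff: "(x, y) \<in> op_adjoint S \<longleftrightarrow> x - R y \<in> K"
proof
  assume "(x, y) \<in> op_adjoint S"
  from graph_subspace_diff[OF op_adjoint_subspace this R_in_op_adjoint[of y]]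
  show "x - R y \<in> K" by (simp add: op_ker_def)
next
  assume "x - R y \<in> K"
  then have "(x - R y + R y, 0 + y) \<in> op_adjoint S"
    using op_adjoint_subspace R_in_op_adjoint unfolding op_ker_def graph_subspace_iff by blast
  then show "(x, y) \<in> op_adjoint S" by simp
qed

lemma K_subspace: "complex_vector.subspace K"
  unfolding complex_vector.subspace_def op_ker_def mem_Collect_eq
proof (intro conjI ballI allI)
  show "(0, 0) \<in> op_adjoint S"
    using op_adjoint_subspace by (simp add: graph_subspace_iff)
next
  fix x y assume "x \<in> {x. (x, 0) \<in> op_adjoint S}" "y \<in> {x. (x, 0) \<in> op_adjoint S}"
  then have "(x + y, 0 + 0) \<in> op_adjoint S"
    using op_adjoint_subspace unfolding graph_subspace_iff by blast
  then show "(x + y, 0) \<in> op_adjoint S" by simp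
next
  fix c x assume "x \<in> {x. (x, 0) \<in> op_adjoint S}"
  then have "(c *\<^sub>C x, c *\<^sub>C 0) \<in> op_adjoint S"
    using op_adjoint_subspace unfolding graph_subspace_iff by blast
  then show "(c *\<^sub>C x, 0) \<in> op_adjoint S" by simp
qed

lemma closed_K: "closed K"
  by (simp add: op_ker_op_adjoint closed_orth_complement)

lemma closure_Range_orth_K: "g \<in> closure (Range S) \<Longrightarrow> k \<in> K \<Longrightarrow> cinner g k = 0"
  unfolding op_ker_op_adjoint orth_complement_closure[of "Range S", symmetric]
  by (simp add: orth_complement_def)

text \<open>\<open>S\<close> is the image of its range under the continuous map sending
  \<open>z\<close> to \<open>(R z, z)\<close>, so closing \<open>S\<close> amounts to closing the
  range.\<close>

lemma closure_S_iff: "(x, y) \<in> closure S \<longleftrightarrow> x = R y \<and> y \<in> closure (Range S)"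
proof
  assume xy: "(x, y) \<in> closure S"
  have "snd ` closure S \<subseteq> closure (snd ` S)"
    by (intro image_closure_subset closure_subset closed_closure continuous_intros)
  moreover have "snd ` S = Range S" by force
  ultimately show "x = R y \<and> y \<in> closure (Range S)"
    using xy closure_S_le_SD SD_iff by force
next
  assume *: "x = R y \<and> y \<in> closure (Range S)"
  have "(\<lambda>z. (R z, z)) ` closure (Range S) \<subseteq> closure S"
  proof (rule image_closure_subset)
    show "continuous_on (closure (Range S)) (\<lambda>z. (R z, z))"
      by (intro continuous_intros bounded_linear.continuous_on[OF bounded_linear_R])
    show "(\<lambda>z. (R z, z)) ` Range S \<subseteq> closure S"
    proof clarify
      fix x y assume xy: "(x, y) \<in> S"
      then have "x = R y" using S_le_SD by (simp add: subset_iff flip: SD_iff)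
      with xy show "(R y, y) \<in> closure S" using closure_subset by blast
    qed
  qed simp
  with * show "(x, y) \<in> closure S" by blast
qed

end

section \<open>The extension with Birman parameter \<open>T\<close>\<close>

locale birman_parameter = invertible_self_adjoint_extension S SD
  for S SD :: "'h::complex_hilbert_space graph" +
  fixes T :: "'h graph" and U :: "'h set"
  assumes U_subspace: "complex_vector.subspace U" and U_closed: "closed U"
    and U_le_K: "U \<subseteq> op_ker (op_adjoint S)" and T_self_adjoint: "self_adjoint_in U T"
begin

lemma T_subspace: "graph_subspace T" and T_single_valued: "single_valued T"
  and T_le: "T \<subseteq> U \<times> U" and U_le_closure: "U \<subseteq> closure (Domain T)"
  using T_self_adjoint by (auto simp: self_adjoint_in_def linear_operator_def)

text \<open>\<open>Domain T\<close> is dense in \<open>U\<close>, so the condition on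
  \<open>w\<close> in \<open>birman_extension\<close> can be stated with \<open>U\<close>.\<close>

lemma orth_complement_Domain_T: "orth_complement (Domain T) = orth_complement U"
proof
  have "orth_complement (closure (Domain T)) \<subseteq> orth_complement U"
    using U_le_closure unfolding orth_complement_def by blast
  then show "orth_complement (Domain T) \<subseteq> orth_complement U"
    by (simp only: orth_complement_closure)
qed (use T_le in \<open>auto simp: orth_complement_def\<close>)

text \<open>As \<open>U \<subseteq> K\<close>, the space \<open>orth_complement U\<close> is the sum
  of \<open>closure (Range S)\<close> and \<open>K \<inter> orth_complement U\<close>. With
  \<open>f = R g\<close>, the vectors \<open>g\<close> and \<open>w\<close> therefore merge into the
  single remainder \<open>y - t\<close>, while \<open>v\<close> becomes
  \<open>x - R y\<close>.\<close>

lemma birman_extension_iff: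
  "(x, y) \<in> birman_extension S SD T \<longleftrightarrow> (\<exists>t. (x - R y, t) \<in> T \<and> y - t \<in> orth_complement U)"
  (is "?L \<longleftrightarrow> ?R")
proof
  assume ?L
  then obtain f v w where xy: "(x, y) \<in> op_adjoint S" and x: "x = f + R (op_app T v + w) + v"
    and f: "f \<in> Domain (closure S)" and v: "v \<in> Domain T" and w: "w \<in> K" "w \<in> orth_complement U"
    unfolding birman_extension_def R_def orth_complement_Domain_T by auto
  define t where "t = op_app T v"
  have t: "(v, t) \<in> T"
    using op_app_iff[OF T_single_valued v, of t] by (simp add: t_def)
  from f obtain g where g: "f = R g" "g \<in> closure (Range S)"
    by (auto simp: closure_S_iff)
  have x': "x - R (g + t + w) = v"
    using x g by (simp add: R_add t_def)
  have "v \<in> K" using t T_le U_le_K by blast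
  \<comment> \<open>The adjoint is single valued, so this second image of \<open>x\<close> must be
    \<open>y\<close>.\<close>
  then have "(x, g + t + w) \<in> op_adjoint S"
    using x' by (simp add: op_adjoint_iff)
  with xy have y: "y = g + t + w"
    using single_valued_op_adjoint[OF S_dense] by (auto dest: single_valuedD)
  have "cinner k (g + w) = 0" if "k \<in> U" for k
    using closure_Range_orth_K[OF g(2), of k] that U_le_K w(2)
    by (auto simp: cinner_add_right orth_complement_def cinner_eq_0_commute[of k g])
  then have "y - t \<in> orth_complement U"
    by (simp add: y orth_complement_def)
  then show ?R
    using t x' y by auto
next
  assume ?R
  then obtain t where t: "(x - R y, t) \<in> T" and yt: "y - t \<in> orth_complement U" by blast
  \<comment> \<open>Split \<open>y - t\<close> along \<open>closure (Range S)\<close> and its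
    complement \<open>K\<close>: the first part supplies \<open>f = R p\<close>, the second supplies
    \<open>w\<close>.\<close>
  obtain p where p: "p \<in> closure (Range S)" "y - t - p \<in> orth_complement (closure (Range S))"
    using projection_exists[of "closure (Range S)" "y - t"] S_subspace
    by (metis complex_subspace_Range subspace_closure closed_closure)
  define w where "w = y - t - p"
  have w: "w \<in> K"
    using p(2) by (simp add: w_def orth_complement_closure op_ker_op_adjoint)
  have "cinner k w = 0" if "k \<in> U" for k
    using closure_Range_orth_K[OF p(1), of k] that U_le_K yt
    by (auto simp: w_def cinner_diff_right orth_complement_def cinner_eq_0_commute[of k p])
  then have w': "w \<in> orth_complement U" by (auto simp: orth_complement_def)
  have "x = R p + R (op_app T (x - R y) + w) + (x - R y)"
    using op_app_eq[OF T_single_valued t] by (simp add: w_def R_diff R_add)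
  moreover have "R p \<in> Domain (closure S)"
    using p(1) closure_S_iff by blast
  moreover have "(x, y) \<in> op_adjoint S"
    using t T_le U_le_K by (auto simp: op_adjoint_iff)
  ultimately show ?L
    using t w w' unfolding birman_extension_def R_def orth_complement_Domain_T by blast
qed

text \<open>The witness is \<open>t = 0\<close>: here \<open>x - R y = 0\<close>, and
  \<open>y\<close> lies in the range of \<open>S\<close>, which is orthogonal to \<open>K\<close>
  and so to \<open>U\<close>.\<close>

lemma S_le_birman_extension: "S \<subseteq> birman_extension S SD T"
proof clarify
  fix x y assume xy: "(x, y) \<in> S"
  then have "x = R y" using S_le_SD SD_iff by blast
  moreover have "(0, 0) \<in> T" using T_subspace by (simp add: graph_subspace_iff)
  moreover have "y \<in> closure (Range S)"
    using xy closure_subset[of "Range S"] by blast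
  then have "y \<in> orth_complement U"
    using U_le_K closure_Range_orth_K by (auto simp: orth_complement_def cinner_eq_0_commute[of _ y])
  ultimately show "(x, y) \<in> birman_extension S SD T"
    by (auto simp: birman_extension_iff)
qed

lemma birman_extension_linear: "linear_operator (birman_extension S SD T)"
  unfolding linear_operator_def
proof
  have "single_valued (op_adjoint S)" by (rule single_valued_op_adjoint[OF S_dense])
  then show "single_valued (birman_extension S SD T)"
    by (rule single_valued_subset[rotated]) (auto simp: birman_extension_def)
  show "graph_subspace (birman_extension S SD T)"
    unfolding graph_subspace_iff
  proof (intro conjI allI impI)
    show "(0, 0) \<in> birman_extension S SD T"
      using S_le_birman_extension S_subspace by (auto simp: graph_subspace_iff)
  next
    fix x y x' y' assume "(x, y) \<in> birman_extension S SD T" "(x', y') \<in> birman_extension S SD T"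
    then obtain t t' where t: "(x - R y, t) \<in> T" "(x' - R y', t') \<in> T"
      and o: "y - t \<in> orth_complement U" "y' - t' \<in> orth_complement U"
      by (auto simp: birman_extension_iff)
    have "((x - R y) + (x' - R y'), t + t') \<in> T"
      using t T_subspace by (simp add: graph_subspace_iff)
    moreover have "(x - R y) + (x' - R y') = x + x' - R (y + y')"
      by (simp add: R_add)
    moreover have "y + y' - (t + t') \<in> orth_complement U"
      using o by (simp add: orth_complement_def cinner_diff_right cinner_add_right)
    ultimately show "(x + x', y + y') \<in> birman_extension S SD T"
      unfolding birman_extension_iff by metis
  next
    fix c x y assume "(x, y) \<in> birman_extension S SD T"
    then obtain t where t: "(x - R y, t) \<in> T" and o: "y - t \<in> orth_complement U"
      by (auto simp: birman_extension_iff)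
    have "(c *\<^sub>C (x - R y), c *\<^sub>C t) \<in> T"
      using t T_subspace by (simp add: graph_subspace_iff)
    moreover have "c *\<^sub>C (x - R y) = c *\<^sub>C x - R (c *\<^sub>C y)"
      by (simp add: R_scaleC complex_vector.scale_right_diff_distrib)
    moreover have "c *\<^sub>C y - c *\<^sub>C t \<in> orth_complement U"
      using o by (simp add: orth_complement_def cinner_diff_right cinner_scaleC_right)
    ultimately show "(c *\<^sub>C x, c *\<^sub>C y) \<in> birman_extension S SD T"
      unfolding birman_extension_iff by metis
  qed
qed

lemma cinner_orth_diff:
  assumes "k \<in> U" "y - t \<in> orth_complement U"
  shows "cinner k y = cinner k t \<and> cinner y k = cinner t k"
proof -
  have "cinner k (y - t) = 0" using assms by (simp add: orth_complement_def)
  moreover from this have "cinner (y - t) k = 0" by (metis cinner_eq_0_commute)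
  ultimately show ?thesis by (simp add: cinner_diff_left cinner_diff_right)
qed

text \<open>Split \<open>x\<close> into \<open>x - R y\<close> and \<open>R y\<close>, and
  \<open>x'\<close> likewise. The parts with \<open>R\<close> agree by symmetry of \<open>R\<close>;
  in the others \<open>y\<close> and \<open>y'\<close> are exchanged for \<open>t\<close> and
  \<open>t'\<close>, which leaves the symmetry of \<open>T\<close>.\<close>

lemma birman_extension_symmetric:
  assumes "(x, y) \<in> birman_extension S SD T" "(x', y') \<in> birman_extension S SD T"
  shows "cinner x y' = cinner y x'"
proof -
  obtain t t' where t: "(x - R y, t) \<in> T" "(x' - R y', t') \<in> T"
    and o: "y - t \<in> orth_complement U" "y' - t' \<in> orth_complement U"
    using assms by (auto simp: birman_extension_iff)
  have U: "x - R y \<in> U" "x' - R y' \<in> U"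
    using t T_le by blast+
  have "cinner (x - R y) t' = cinner t (x' - R y')"
    using t self_adjoint_in_adjoint_iff[OF T_self_adjoint] by blast
  then have "cinner (x - R y) y' = cinner y (x' - R y')"
    using cinner_orth_diff[OF U(2) o(1)] cinner_orth_diff[OF U(1) o(2)] by simp
  then show ?thesis
    by (simp add: cinner_diff_left cinner_diff_right R_symmetric)
qed

text \<open>Testing against the elements \<open>R (t + w) + k\<close> with \<open>(k, t) \<in> T\<close> and \<open>w \<in> K\<close> orthogonal to \<open>U\<close>
  suffices for self-adjointness.\<close>

lemma op_adjoint_birman_extension_le:
  "op_adjoint (birman_extension S SD T) \<subseteq> birman_extension S SD T"
proof clarify
  fix x y assume xy: "(x, y) \<in> op_adjoint (birman_extension S SD T)"
  define k where "k = x - R y"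
  have "(x, y) \<in> op_adjoint S"
    using xy S_le_birman_extension by (auto simp: adjoint_in_def)
  then have kK: "k \<in> K" by (simp add: k_def op_adjoint_iff)
  have test: "cinner k (t + w) = cinner y k'"
    if "(k', t) \<in> T" "w \<in> orth_complement U" for k' t w
  proof -
    have "(R (t + w) + k', t + w) \<in> birman_extension S SD T"
      using that by (auto simp: birman_extension_iff intro!: exI[of _ t])
    then have "cinner x (t + w) = cinner y (R (t + w) + k')"
      using xy by (auto simp: adjoint_in_def)
    then show ?thesis
      by (simp add: k_def cinner_diff_left cinner_add_right[of y] R_symmetric)
  qed
  have T0: "(0, 0) \<in> T" using T_subspace by (simp add: graph_subspace_iff)
  obtain p where p: "p \<in> U" "k - p \<in> orth_complement U"
    using projection_exists[OF U_subspace U_closed] by blast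
  \<comment> \<open>The test with \<open>k' = 0\<close>, \<open>t = 0\<close> and
    \<open>w = k - p\<close> kills the component of \<open>k\<close> orthogonal to
    \<open>U\<close>.\<close>
  have "cinner k (k - p) = 0"
    using test[OF T0 p(2)] by simp
  then have "cinner (k - p) (k - p) = 0"
    using p by (simp add: cinner_diff_left orth_complement_def)
  then have kU: "k \<in> U" using p(1) by simp
  obtain t where t: "t \<in> U" "y - t \<in> orth_complement U"
    using projection_exists[OF U_subspace U_closed] by blast
  \<comment> \<open>With \<open>w = 0\<close> the test says that \<open>(k, t)\<close> lies in the
    adjoint of \<open>T\<close> in \<open>U\<close>, where \<open>t\<close> is the projection of
    \<open>y\<close>.\<close>
  have "cinner k t' = cinner t k'" if "(k', t') \<in> T" for k' t'
    using test[OF that, of 0] cinner_orth_diff[OF _ t(2), of k'] that T_le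
    by (auto simp: orth_complement_def)
  then have "(k, t) \<in> T"
    using kU t(1) self_adjoint_in_adjoint_iff[OF T_self_adjoint] by blast
  with t(2) show "(x, y) \<in> birman_extension S SD T"
    by (auto simp: birman_extension_iff k_def)
qed

theorem self_adjoint_birman_extension: "self_adjoint (birman_extension S SD T)"
proof -
  have "closure (Domain S) \<subseteq> closure (Domain (birman_extension S SD T))"
    using S_le_birman_extension by (intro closure_mono) auto
  then have "UNIV \<subseteq> closure (Domain (birman_extension S SD T))"
    using S_dense by (simp add: densely_defined_def)
  moreover have "birman_extension S SD T \<subseteq> op_adjoint (birman_extension S SD T)"
    unfolding adjoint_in_def using birman_extension_symmetric by fast
  ultimately show ?thesis
    using birman_extension_linear op_adjoint_birman_extension_le
    by (simp add: self_adjoint_in_def subset_antisym)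
qed

end

section \<open>Orthonormal systems and multiplicities\<close>

text \<open>Pairing a vanishing combination with one of its vectors isolates that coefficient.
  Injectivity links orthonormality, stated for indices, to independence, stated for the image
  set.\<close>

lemma orthonormal_system_independent:
  assumes "orthonormal_system N v"
  shows "inj_on v N" "complex_vector.independent (v ` N)"
proof -
  have on: "cinner (v m) (v n) = (if m = n then 1 else 0)" if "m \<in> N" "n \<in> N" for m n
    using assms that by (simp add: orthonormal_system_def)
  show inj: "inj_on v N"
  proof (rule inj_onI, rule ccontr)
    fix m n assume mn: "m \<in> N" "n \<in> N" "v m = v n" "m \<noteq> n"
    show False using on[OF mn(1,2)] on[OF mn(1,1)] mn(3,4) by simp
  qed
  show "complex_vector.independent (v ` N)"
    unfolding complex_vector.independent_explicit_module
  proof (intro allI impI)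
    fix B c w assume B: "finite B" "B \<subseteq> v ` N" "(\<Sum>x\<in>B. c x *\<^sub>C x) = 0" and w: "w \<in> B"
    have orth: "cinner w x = (if w = x then 1 else 0)" if x: "x \<in> B" for x
    proof -
      obtain m where m: "w = v m" "m \<in> N" using subsetD[OF B(2) w] by (rule imageE)
      obtain n where n: "x = v n" "n \<in> N" using subsetD[OF B(2) x] by (rule imageE)
      show ?thesis using on[OF m(2) n(2)] inj_on_eq_iff[OF inj m(2) n(2)] m(1) n(1) by simp
    qed
    have "0 = cinner w (\<Sum>x\<in>B. c x *\<^sub>C x)"
      using B(3) by simp
    also have "\<dots> = (\<Sum>x\<in>B. c x * cinner w x)"
      using linear_sum[OF bounded_linear.linear[OF bounded_linear_cinner_right[of w]], of "\<lambda>x. c x *\<^sub>C x" B]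
      by (simp add: cinner_scaleC_right)
    also have "\<dots> = (\<Sum>x\<in>B. if w = x then c x else 0)"
      using orth by (intro sum.cong) auto
    also have "\<dots> = c w"
      using B(1) w by simp
    finally show "c w = 0" by simp
  qed
qed

text \<open>In the finite-dimensional case \<open>B\<close> extends to a maximal independent subset
  of \<open>W\<close>, which is finite and has \<open>cdim W\<close> elements.\<close>

lemma ecard_le_cdimension:
  assumes B: "complex_vector.independent B" "B \<subseteq> W"
  shows "ecard B \<le> cdimension W"
proof (cases "\<exists>F. finite F \<and> W \<subseteq> cspan F")
  case True
  then obtain F where F: "finite F" "W \<subseteq> cspan F" by blast
  obtain C where C: "B \<subseteq> C" "C \<subseteq> W" "complex_vector.independent C" "W \<subseteq> cspan C"
    using complex_vector.maximal_independent_subset_extend[OF B(2,1)] by blast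
  have "finite C"
    using complex_vector.independent_span_bound[OF F(1) C(3)] C(2) F(2) by auto
  then have "finite B" "card B \<le> cdim W"
    using C finite_subset complex_vector.basis_card_eq_dim[OF C(2,4,3)] card_mono by metis+
  then show ?thesis
    using True by (simp add: ecard_def cdimension_def)
next
  case False
  then have "cdimension W = \<infinity>" unfolding cdimension_def by (rule if_not_P)
  then show ?thesis by simp
qed

lemma ecard_image: "inj_on f A \<Longrightarrow> ecard (f ` A) = ecard A"
  by (simp add: ecard_def finite_image_iff card_image)

section \<open>Eigenvalues of the extension\<close>

theorem theorem3p4:
  fixes S SD T :: "'h::complex_hilbert_space graph"
    and a :: ereal and b :: real
    and N :: "'i set" and lam :: "'i \<Rightarrow> real"
    and v u :: "'i \<Rightarrow> 'h" and U :: "'h set"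
  assumes H_infinite_dim: "cdimension (UNIV :: 'h set) = \<infinity>"
    and S: "linear_operator S" "densely_defined S" "symmetric_operator S"
    and gap: "has_gap S a b" and zero_in_gap: "0 \<in> gap_interval a b"
    and deficiency: "cdimension (op_ker (op_adjoint S)) = \<infinity>"
    and SD: "self_adjoint SD" "S \<subseteq> SD" "spectrum SD \<inter> complex_of_real ` gap_interval a b = {}"
    and N: "countable N"
    and lam: "\<forall>n\<in>N. lam n \<in> gap_interval a b"
    and v: "orthonormal_system N v"
      "\<forall>n\<in>N. (v n, complex_of_real (lam n) *\<^sub>C v n) \<in> op_adjoint S"
    and u: "\<forall>n\<in>N. u n = birman_vector SD lam v n"
    and U: "U = closure (cspan (u ` N))"
    and T: "T = matrix_operator N u (birman_matrix SD lam v)" "self_adjoint_in U T"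
  shows "self_adjoint (birman_extension S SD T) \<and> S \<subseteq> birman_extension S SD T \<and>
    (\<forall>n\<in>N. eigenvalue (birman_extension S SD T) (complex_of_real (lam n))) \<and>
    (\<forall>n\<in>N. ecard {m \<in> N. lam m = lam n}
       \<le> eigenvalue_multiplicity (birman_extension S SD T) (complex_of_real (lam n)))"
proof -
  \<comment> \<open>\<open>0\<close> lies in the gap and hence off the spectrum, so
    \<open>SD\<close> is boundedly invertible.\<close>
  have "complex_of_real 0 \<notin> spectrum SD"
    using SD(3) zero_in_gap by blast
  then interpret invertible_self_adjoint_extension S SD
    using S SD by unfold_locales (auto simp: spectrum_def)
  \<comment> \<open>In this form \<open>u n\<close> is the \<open>K\<close>-component of
    \<open>v n\<close> in the decomposition of \<open>op_adjoint_iff\<close>.\<close>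
  have u_eq: "u n = v n - R (complex_of_real (lam n) *\<^sub>C v n)" if "n \<in> N" for n
  proof -
    have "(R (v n), v n - complex_of_real (lam n) *\<^sub>C R (v n)) \<in> op_shift SD (complex_of_real (lam n))"
      using SD_iff by (auto simp: op_shift_def)
    moreover have "single_valued (op_shift SD (complex_of_real (lam n)))"
      using SD(1) by (auto simp: op_shift_def single_valued_def self_adjoint_in_def linear_operator_def)
    ultimately show ?thesis
      using u that by (simp add: birman_vector_def op_app_eq R_scaleC flip: R_def)
  qed
  have "u ` N \<subseteq> K"
    using v(2) u_eq by (auto simp: op_adjoint_iff)
  then have "U \<subseteq> K"
    unfolding U by (intro closure_minimal complex_vector.span_minimal K_subspace closed_K)
  then interpret birman_parameter S SD T U
    using T(2) by unfold_locales (auto simp: U intro: subspace_closure complex_vector.subspace_span)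
  have eigenvector: "(v n, complex_of_real (lam n) *\<^sub>C v n) \<in> birman_extension S SD T" if n: "n \<in> N" for n
  proof -
    \<comment> \<open>This projection is the candidate for the value of \<open>T\<close> at
      \<open>u n\<close>.\<close>
    obtain t where t: "t \<in> U" "complex_of_real (lam n) *\<^sub>C v n - t \<in> orth_complement U"
      using projection_exists[OF U_subspace U_closed] by blast
    have "cinner (u m) t = birman_matrix SD lam v m n" if m: "m \<in> N" for m
    proof -
      have "u m \<in> cspan (u ` N)"
        using m by (intro complex_vector.span_base imageI)
      then have "u m \<in> U"
        unfolding U by (rule subsetD[OF closure_subset])
      then have "cinner (u m) t = complex_of_real (lam n) * cinner (u m) (v n)"
        using cinner_orth_diff[OF _ t(2)] by (metis cinner_scaleC_right)
      then show ?thesis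
        using u m birman_matrix_eq[OF SD(1) SD_converse, of lam v m n] by simp
    qed
    \<comment> \<open>The pair is one of the generators in \<open>matrix_operator\<close>, so it
      lies in the span even before closure.\<close>
    then have "(u n, t) \<in> T"
      unfolding T(1) matrix_operator_def using n t(1)
      by (intro subsetD[OF closure_subset] graph.span_base) (auto simp: U)
    then show ?thesis
      using u_eq[OF n] t(2) by (auto simp: birman_extension_iff)
  qed
  have "eigenvalue (birman_extension S SD T) (complex_of_real (lam n))" if n: "n \<in> N" for n
  proof -
    have "v n \<noteq> 0"
      using v(1) n by (force simp: orthonormal_system_def)
    then show ?thesis
      using eigenvector[OF n] by (auto simp: eigenvalue_def eigenspace_iff)
  qed
  moreover have "ecard {m \<in> N. lam m = lam n}
      \<le> eigenvalue_multiplicity (birman_extension S SD T) (complex_of_real (lam n))" for n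
  proof -
    \<comment> \<open>The indices sharing one value give an orthonormal subsystem inside a single
      eigenspace.\<close>
    have "orthonormal_system {m \<in> N. lam m = lam n} v"
      using v(1) by (simp add: orthonormal_system_def)
    note indep = orthonormal_system_independent[OF this]
    have "v ` {m \<in> N. lam m = lam n} \<subseteq> eigenspace (birman_extension S SD T) (complex_of_real (lam n))"
      using eigenvector by (force simp: eigenspace_iff)
    from ecard_le_cdimension[OF indep(2) this] show ?thesis
      by (simp add: ecard_image[OF indep(1)] eigenvalue_multiplicity_def)
  qed
  ultimately show ?thesis
    using self_adjoint_birman_extension S_le_birman_extension by blast
qed

end
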